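(* Let $f:\mathbb{R}^d\to\mathbb{C}$ be a $d$-dimensional quasiperiodic function, with parent function $F$ on $\mathbb{R}^n$ and projection matrix $\boldsymbol{P}\in\mathbb{P}^{d\times n}$ such that $f(\boldsymbol{x})=F(\boldsymbol{P}^T\boldsymbol{x})$ for all $\boldsymbol{x}\in\mathbb{R}^d$. Then $$f(\boldsymbol{x})=F(\mathcal{C}(\boldsymbol{x})),\qquad \forall \boldsymbol{x}\in\mathbb{R}^d,$$ where $\mathcal{C}=\mathcal{M}\circ\mathcal{L}$ is the combination map associated with $\boldsymbol{P}$.
   Context: A matrix $\boldsymbol{P}=(\boldsymbol{p}_1,\dots,\boldsymbol{p}_n)\in\mathbb{R}^{d\times n}$ is a projection matrix, written $\boldsymbol{P}\in\mathbb{P}^{d\times n}$, if $\mathrm{rank}_{\mathbb{R}}(\boldsymbol{P})=d$ and its columns $\boldsymbol{p}_1,\dots,\boldsymbol{p}_n$ are linearly independent over $\mathbb{Q}$. A function $f$ on $\mathbb{R}^d$ is quasiperiodic if there exist an $n$-dimensional periodic function $F$ on $\mathbb{R}^n$ (called the parent function of $f$) and $\boldsymbol{P}\in\mathbb{P}^{d\times n}$ such that $f(\boldsymbol{x})=F(\boldsymbol{P}^T\boldsymbol{x})$ for all $\boldsymbol{x}\in\mathbb{R}^d$. Throughout, the unit cell of the periodic function $F$ is the cube $\Omega=[0,1)^n$, i.e. $F(\boldsymbol{s}+\boldsymbol{R})=F(\boldsymbol{s})$ for all $\boldsymbol{R}\in\mathbb{Z}^n$. The lift map is $\mathcal{L}:\mathbb{R}^d\to\mathbb{R}^n$,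 $\boldsymbol{x}\mapsto\boldsymbol{P}^T\boldsymbol{x}$. The modulo map is $\mathcal{M}:\mathbb{R}^n\to\mathbb{T}^n=\mathbb{R}^n/\mathbb{Z}^n$, $\boldsymbol{s}\mapsto\overline{\boldsymbol{s}}=\boldsymbol{s}+\mathbb{Z}^n$. $\mathbb{T}^n$ is identified with $\Omega=[0,1)^n$ by sending each coset to its representative in $[0,1)^n$; $F$ is evaluated at a point of $\mathbb{T}^n$ via this representative. *)

theory Defs
  imports "HOL-Analysis.Analysis"
begin

text \<open>
  A \<open>d \<times> n\<close> real matrix is an element of \<^typ>\<open>real ^ 'n ^ 'd\<close> (rows indexed by
  \<open>'d\<close>, columns by \<open>'n\<close>), so its columns live in \<^typ>\<open>real ^ 'd\<close>.
\<close>

abbreviation scaleQ :: "rat \<Rightarrow> 'a::real_vector \<Rightarrow> 'a" where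
  "scaleQ q v \<equiv> of_rat q *\<^sub>R v"

lemma module_scaleQ: "Modules.module (scaleQ :: rat \<Rightarrow> 'a::real_vector \<Rightarrow> 'a)"
  by unfold_locales
    (simp_all add: scaleR_add_right scaleR_add_left of_rat_add of_rat_mult)

text \<open>
  Linear independence of \<open>p\<^sub>1, \<dots>, p\<^sub>n\<close> is meant as that of a family, whereas
  \<^const>\<open>columns\<close> is a set; hence the injectivity requirement.
\<close>

definition projection_matrix :: "real ^ 'n ^ 'd \<Rightarrow> bool" where
  "projection_matrix P \<longleftrightarrow>
     rank P = CARD('d) \<and>
     inj (\<lambda>j. column j P) \<and> module.independent scaleQ (columns P)"

definition int_lattice :: "(real ^ 'n) set" where
  "int_lattice = {r. \<forall>i. r $ i \<in> \<int>}"

definition unit_cell :: "(real ^ 'n) set" where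
  "unit_cell = {s. \<forall>i. 0 \<le> s $ i \<and> s $ i < 1}"

definition unit_periodic :: "(real ^ 'n \<Rightarrow> 'b) \<Rightarrow> bool" where
  "unit_periodic F \<longleftrightarrow> (\<forall>s. \<forall>r\<in>int_lattice. F (s + r) = F s)"

definition lift_map :: "real ^ 'n ^ 'd \<Rightarrow> real ^ 'd \<Rightarrow> real ^ 'n" where
  "lift_map P x = transpose P *v x"

text \<open>
  \<open>f\<close> is quasiperiodic if this holds for some \<open>F\<close> and \<open>P\<close>, in some dimension \<open>n\<close>.
\<close>

definition quasiperiodic_with ::
    "(real ^ 'd \<Rightarrow> complex) \<Rightarrow> (real ^ 'n \<Rightarrow> complex) \<Rightarrow> real ^ 'n ^ 'd \<Rightarrow> bool" where
  "quasiperiodic_with f F P \<longleftrightarrow>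
     unit_periodic F \<and> projection_matrix P \<and> (\<forall>x. f x = F (transpose P *v x))"

text \<open>Points of the torus are cosets of the integer lattice, i.e. sets of vectors.\<close>

definition torus :: "(real ^ 'n) set set" where
  "torus = UNIV // {(s, t). t - s \<in> int_lattice}"

definition modulo_map :: "real ^ 'n \<Rightarrow> (real ^ 'n) set" where
  "modulo_map s = (\<lambda>r. s + r) ` int_lattice"

definition combination_map :: "real ^ 'n ^ 'd \<Rightarrow> real ^ 'd \<Rightarrow> (real ^ 'n) set" where
  "combination_map P = modulo_map \<circ> lift_map P"

text \<open>The identification of the torus with the unit cell; see \<open>bij_betw_torus_rep\<close>.\<close>

definition torus_rep :: "(real ^ 'n) set \<Rightarrow> real ^ 'n" where
  "torus_rep t = (THE s. s \<in> t \<and> s \<in> unit_cell)"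

lemma modulo_map_eq: "modulo_map s = {(s, t). t - s \<in> int_lattice} `` {s}"
  unfolding modulo_map_def by (auto simp: image_iff) (metis add_diff_cancel_left' diff_add_cancel add.commute)

lemma torus_eq_range: "torus = range modulo_map"
proof -
  have "modulo_map s = {(s, t). t - s \<in> int_lattice} `` {s}" for s :: "real ^ 'n"
    by (rule modulo_map_eq)
  then show ?thesis
    unfolding torus_def quotient_def by auto
qed

lemma torus_rep_ex1:
  assumes "t \<in> torus"
  shows "\<exists>!s. s \<in> t \<and> s \<in> unit_cell"
proof -
  obtain s where t: "t = modulo_map s"
    using assms by (auto simp: torus_eq_range)
  have mem: "u \<in> t \<longleftrightarrow> (\<forall>i. u $ i - s $ i \<in> \<int>)" for u
    unfolding t modulo_map_eq int_lattice_def by simp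
  show ?thesis
  proof (rule ex1I[of _ "\<chi> i. frac (s $ i)"])
    show "(\<chi> i. frac (s $ i)) \<in> t \<and> (\<chi> i. frac (s $ i)) \<in> unit_cell"
      by (simp add: mem unit_cell_def frac_lt_1) (simp add: frac_def)
  next
    fix u assume u: "u \<in> t \<and> u \<in> unit_cell"
    have "u $ i = frac (s $ i)" for i
    proof -
      have "s $ i - u $ i \<in> \<int>"
        using u mem[of u] by (metis Ints_minus minus_diff_eq)
      then show ?thesis
        using u by (metis (mono_tags, lifting) frac_unique_iff mem_Collect_eq unit_cell_def)
    qed
    then show "u = (\<chi> i. frac (s $ i))"
      by (simp add: vec_eq_iff)
  qed
qed

lemma bij_betw_torus_rep: "bij_betw torus_rep torus unit_cell"
proof (rule bij_betw_byWitness[where f' = modulo_map])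
  have rep: "torus_rep t \<in> t \<and> torus_rep t \<in> unit_cell" if "t \<in> torus" for t :: "(real ^ 'n) set"
    unfolding torus_rep_def by (rule theI'[OF torus_rep_ex1[OF that]])
  then show "torus_rep ` torus \<subseteq> unit_cell"
    by auto
  show "modulo_map ` unit_cell \<subseteq> torus"
    by (auto simp: torus_eq_range)
  show "\<forall>t\<in>torus. modulo_map (torus_rep t) = t"
  proof
    fix t :: "(real ^ 'n) set" assume t: "t \<in> torus"
    then obtain s where s: "t = modulo_map s"
      by (auto simp: torus_eq_range)
    have st: "torus_rep t $ i - s $ i \<in> \<int>" for i
      using rep[OF t] unfolding s modulo_map_eq int_lattice_def by simp
    have "u $ i - torus_rep t $ i \<in> \<int> \<longleftrightarrow> u $ i - s $ i \<in> \<int>" for u :: "real ^ 'n" and i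
      using Ints_add[OF _ st[of i], of "u $ i - torus_rep t $ i"]
        Ints_diff[OF _ st[of i], of "u $ i - s $ i"] by auto
    then have "modulo_map (torus_rep t) = modulo_map s"
      unfolding modulo_map_eq int_lattice_def by auto
    with s show "modulo_map (torus_rep t) = t" by simp
  qed
  show "\<forall>s\<in>unit_cell. torus_rep (modulo_map s) = (s :: real ^ 'n)"
  proof
    fix s :: "real ^ 'n" assume "s \<in> unit_cell"
    moreover have "s \<in> modulo_map s"
      unfolding modulo_map_eq int_lattice_def by simp
    moreover have "modulo_map s \<in> torus"
      by (simp add: torus_eq_range)
    ultimately show "torus_rep (modulo_map s) = s"
      using rep[of "modulo_map s"] torus_rep_ex1[of "modulo_map s"] by blast
  qed
qed

end

theory Submission
  imports Defs
begin

text \<open>The unit-cell representative of a coset lies in that coset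
  (\<open>torus_rep_modulo_map_in\<close>), so it differs from \<open>lift_map P x\<close> by an
  integer vector, a shift that leaves \<open>F\<close> unchanged by periodicity
  (\<open>unit_periodic_torus_rep\<close>).\<close>

lemma torus_rep_modulo_map_in: "torus_rep (modulo_map s) \<in> modulo_map s"
proof -
  have "modulo_map s \<in> torus"
    by (simp add: torus_eq_range)
  \<comment> \<open>\<open>torus_rep\<close> is a definite description: unique existence on
    \<open>torus\<close> is what yields its defining property.\<close>
  from theI'[OF torus_rep_ex1[OF this]] show ?thesis
    unfolding torus_rep_def by blast
qed

lemma unit_periodic_torus_rep:
  assumes "unit_periodic F"
  shows "F (torus_rep (modulo_map s)) = F s"
proof -
  obtain r where "r \<in> int_lattice" "torus_rep (modulo_map s) = s + r"
    using torus_rep_modulo_map_in[of s] unfolding modulo_map_def by blast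
  with assms show ?thesis
    by (simp add: unit_periodic_def)
qed

theorem theorem3p5:
  fixes f :: "real ^ 'd \<Rightarrow> complex"
    and F :: "real ^ 'n \<Rightarrow> complex"
    and P :: "real ^ 'n ^ 'd"
  assumes "quasiperiodic_with f F P"
  shows "\<forall>x. f x = F (torus_rep (combination_map P x))"
  using assms
  by (simp add: quasiperiodic_with_def combination_map_def lift_map_def unit_periodic_torus_rep)

end
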